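(* Let $\mathbb{F}$ be a field such that $O(\mathbb{F},2)\neq 0$ and let $n\ge1$ be an integer. Then $\omega(TD(\mathbb{F},n))\geq |\mathbb{F}|^{[\frac{n}{2}]}-1$. If $n$ is an odd number, then $\omega(TD(\mathbb{F},n))\geq |\mathbb{F}|^{[\frac{n}{2}]}$.
   Context: For a commutative ring $R$ with nonzero identity and an integer $n\ge1$, $TD(R,n)$ is the simple graph with vertex set $R^n\setminus\{(0,\ldots,0)\}$ in which two distinct vertices $\mathbf{x},\mathbf{y}$ are adjacent if and only if $\mathbf{x}\cdot\mathbf{y}=\sum_{i=1}^n x_iy_i=0$ in $R$. $O(R,n)$ denotes the number of non-trivial (i.e. nonzero) solutions $(x_1,\ldots,x_n)\in R^n$ of $x_1^2+\cdots+x_n^2=0$. $\omega(G)$ is the clique number of $G$ (largest size of a set of pairwise adjacent vertices); $[\,\cdot\,]$ denotes the integer part. If $\mathbb{F}$ is infinite, sizes are read as cardinalities. *)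

theory Defs
  imports "Jordan_Normal_Form.Matrix" "HOL-Library.Ramsey"
begin

unbundle cardinal_syntax

text \<open>
  A simple graph is a pair of a vertex set and a set of two-element edges, as in
  \<^const>\<open>clique\<close>. Sizes are cardinals in the sense of the library's cardinal orders, so that
  finite and infinite fields are treated alike (\<^const>\<open>card\<close> would give \<open>0\<close> on infinite sets).
\<close>

type_synonym 'v ugraph = "'v set \<times> 'v set set"

definition TD :: "nat \<Rightarrow> 'a::comm_ring_1 vec ugraph" where
  "TD n = (let V = carrier_vec n - {0\<^sub>v n}
           in (V, {{x, y} | x y. x \<in> V \<and> y \<in> V \<and> x \<noteq> y \<and> x \<bullet> y = 0}))"

definition O_number :: "nat \<Rightarrow> 'a::comm_ring_1 vec rel" where
  "O_number n = |{x \<in> carrier_vec n. x \<noteq> 0\<^sub>v n \<and> (\<Sum>i<n. (x $ i)\<^sup>2) = 0}|"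

definition clique_bound :: "'v ugraph \<Rightarrow> 'v rel \<Rightarrow> bool" where
  "clique_bound G \<kappa> \<longleftrightarrow>
     Card_order \<kappa> \<and> (\<forall>C. C \<subseteq> fst G \<and> clique C (snd G) \<longrightarrow> |C| \<le>o \<kappa> )"

text \<open>
  The supremum of the cardinalities of the cliques. It is determined up to \<open>=o\<close>; the bounds can be
  taken on the vertex type because the cardinal of the vertex set is itself a bound.
\<close>

definition clique_number :: "'v ugraph \<Rightarrow> 'v rel" where
  "clique_number G = (SOME \<kappa>. clique_bound G \<kappa> \<and> (\<forall>\<mu>. clique_bound G \<mu> \<longrightarrow> \<kappa> \<le>o \<mu>))"

lemma clique_number_least_bound:
  "clique_bound G (clique_number G)"
  "clique_bound G \<mu> \<Longrightarrow> clique_number G \<le>o \<mu>"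
proof -
  have "clique_bound G |fst G|"
    by (auto simp: clique_bound_def card_of_Card_order intro: card_of_mono1)
  then have "\<exists>\<kappa>\<in>Collect (clique_bound G). \<forall>\<mu>\<in>Collect (clique_bound G). \<kappa> \<le>o \<mu>"
    by (intro exists_minim_Card_order) (auto simp: clique_bound_def)
  then have "\<exists>\<kappa>. clique_bound G \<kappa> \<and> (\<forall>\<mu>. clique_bound G \<mu> \<longrightarrow> \<kappa> \<le>o \<mu>)"
    by blast
  from someI_ex[OF this] show "clique_bound G (clique_number G)"
    "clique_bound G \<mu> \<Longrightarrow> clique_number G \<le>o \<mu>"
    unfolding clique_number_def by blast+
qed

lemma clique_number_largest:
  assumes "C \<subseteq> fst G" "clique C (snd G)"
    and "\<And>D. D \<subseteq> fst G \<Longrightarrow> clique D (snd G) \<Longrightarrow> |D| \<le>o |C|"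
  shows "clique_number G =o |C|"
proof -
  have "clique_bound G |C|"
    using assms(3) by (auto simp: clique_bound_def card_of_Card_order)
  then have "clique_number G \<le>o |C|"
    by (rule clique_number_least_bound)
  moreover have "|C| \<le>o clique_number G"
    using clique_number_least_bound(1)[of G] assms(1,2) by (auto simp: clique_bound_def)
  ultimately show ?thesis
    by (simp add: ordIso_iff_ordLeq)
qed

text \<open>
  The cardinal \<open>\<kappa> - 1\<close>, realised by deleting one point. For an infinite \<open>\<kappa>\<close> this is \<open>\<kappa>\<close>.
\<close>

definition cminus_one :: "'b rel \<Rightarrow> 'b rel" where
  "cminus_one \<kappa> = |Field \<kappa> - {SOME a. a \<in> Field \<kappa>}|"

lemma cminus_one_card_of: "a \<in> A \<Longrightarrow> cminus_one |A| =o |A - {a}|"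
proof -
  assume a: "a \<in> A"
  define b where "b = (SOME a. a \<in> A)"
  have b: "b \<in> A" unfolding b_def using a by (rule someI)
  have "bij_betw (Transposition.transpose a b) (A - {b}) (A - {a})"
    by (rule bij_betw_byWitness[where f' = "Transposition.transpose a b"])
      (use a b in \<open>auto simp: Transposition.transpose_def\<close>)
  then show ?thesis
    unfolding cminus_one_def Field_card_of b_def[symmetric] using card_of_ordIso by blast
qed

lemma cminus_one_infinite: "infinite A \<Longrightarrow> cminus_one |A| =o |A|"
  unfolding cminus_one_def Field_card_of
  by (meson infinite_imp_bij_betw card_of_ordIso ordIso_symmetric)

lemma card_Field_cminus_one: "finite A \<Longrightarrow> card (Field (cminus_one |A| )) = card A - 1"
  unfolding cminus_one_def Field_card_of by (cases "A = {}") (simp_all add: some_in_eq)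

end

theory Submission
  imports Defs
begin

text \<open>
  A non-trivial solution of \<open>a\<^sup>2 + b\<^sup>2 = 0\<close> has \<open>a \<noteq> 0\<close>, so \<open>c = b / a\<close> satisfies
  \<open>c * c = - 1\<close>. With \<open>m = n div 2\<close>, the vectors \<open>(f\<^sub>0, c f\<^sub>0, f\<^sub>1, c f\<^sub>1, \<dots>)\<close>, padded by \<open>0\<close> when \<open>n\<close>
  is odd, form an \<open>m\<close>-dimensional subspace on which the dot product vanishes identically, because
  the two coordinates of each pair contribute \<open>f\<^sub>j g\<^sub>j + c\<^sup>2 f\<^sub>j g\<^sub>j = 0\<close>. Its nonzero vectors are a
  clique with \<open>|F|\<^sup>m - 1\<close> elements. For odd \<open>n\<close> the last unit vector is orthogonal to the whole
  subspace and lies outside it, so the clique can be enlarged by one vertex, which takes the place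
  of the deleted zero vector. The argument uses only an injective parametrisation of the subspace
  by functions and is therefore the same for finite and infinite fields.
\<close>

lemma card_le_clique_number:
  assumes "C \<subseteq> fst G" "clique C (snd G)"
  shows "|C| \<le>o clique_number G"
  using clique_number_least_bound(1)[of G] assms by (auto simp: clique_bound_def)

lemma TD_clique_card_le:
  fixes C :: "'a::comm_ring_1 vec set"
  assumes "C \<subseteq> carrier_vec n - {0\<^sub>v n}"
    and "\<And>x y. x \<in> C \<Longrightarrow> y \<in> C \<Longrightarrow> x \<noteq> y \<Longrightarrow> x \<bullet> y = 0"
  shows "|C| \<le>o clique_number (TD n :: 'a vec ugraph)"
proof (rule card_le_clique_number)
  show "C \<subseteq> fst (TD n)"
    using assms(1) by (simp add: TD_def)
  have "{x, y} \<in> snd (TD n)" if "x \<in> C" "y \<in> C" "x \<noteq> y" for x y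
    unfolding TD_def Let_def snd_conv using assms(1) assms(2)[OF that] that by blast
  then show "clique C (snd (TD n))"
    by (simp add: clique_def)
qed

lemma sqrt_minus_one_if_O_number_2:
  assumes "\<not> (O_number 2 :: 'a::field vec rel) =o (czero :: 'a vec rel)"
  obtains c :: "'a::field" where "c * c = - 1"
proof -
  have "{x :: 'a vec. x \<in> carrier_vec 2 \<and> x \<noteq> 0\<^sub>v 2 \<and> (\<Sum>i<2. (x $ i)\<^sup>2) = 0} \<noteq> {}"
  proof
    assume "{x :: 'a vec. x \<in> carrier_vec 2 \<and> x \<noteq> 0\<^sub>v 2 \<and> (\<Sum>i<2. (x $ i)\<^sup>2) = 0} = {}"
    then have "(O_number 2 :: 'a vec rel) = |{}|"
      by (simp only: O_number_def)
    with assms show False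
      by (simp add: czero_def card_of_refl)
  qed
  then obtain x :: "'a vec"
    where x: "x \<in> carrier_vec 2" "x \<noteq> 0\<^sub>v 2" "(x $ 0)\<^sup>2 + (x $ 1)\<^sup>2 = 0"
    by (auto simp: numeral_2_eq_2)
  have "x $ 0 \<noteq> 0"
  proof
    assume "x $ 0 = 0"
    with x(3) have "x $ 0 = 0" "x $ 1 = 0" by simp_all
    then have "x = 0\<^sub>v 2"
      using x(1) by (intro eq_vecI) (auto simp: less_2_cases_iff)
    with x(2) show False by contradiction
  qed
  moreover have "x $ 1 * x $ 1 = - (x $ 0 * x $ 0)"
    using x(3) by (simp add: power2_eq_square add_eq_0_iff)
  ultimately have "(x $ 1 / x $ 0) * (x $ 1 / x $ 0) = - 1"
    by (simp add: field_simps)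
  then show thesis by (rule that)
qed

definition isotropic_vec :: "'a::comm_ring_1 \<Rightarrow> nat \<Rightarrow> (nat \<Rightarrow> 'a) \<Rightarrow> 'a vec" where
  "isotropic_vec c n f =
     vec n (\<lambda>k. if k < 2 * (n div 2) then (if even k then f (k div 2) else c * f (k div 2)) else 0)"

lemma isotropic_vec_carrier [simp]: "isotropic_vec c n f \<in> carrier_vec n"
  by (simp add: isotropic_vec_def)

lemma isotropic_vec_even:
  "j < n div 2 \<Longrightarrow> isotropic_vec c n f $ (2 * j) = f j"
  by (simp add: isotropic_vec_def)

lemma sum_pairs: "(\<Sum>k<2 * m. h k) = (\<Sum>j<m. h (2 * j) + h (Suc (2 * j)))"
  for h :: "nat \<Rightarrow> 'a::comm_monoid_add"
  by (induction m) (simp_all add: add.assoc)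

text \<open>
  The dot product cancels within each pair of coordinates, since \<open>1 + c\<^sup>2 = 0\<close>.
\<close>

lemma isotropic_vec_orthogonal:
  fixes c :: "'a::comm_ring_1"
  assumes "c * c = - 1"
  shows "isotropic_vec c n f \<bullet> isotropic_vec c n g = 0"
proof -
  let ?h = "\<lambda>k. isotropic_vec c n f $ k * isotropic_vec c n g $ k"
  have "isotropic_vec c n f \<bullet> isotropic_vec c n g = (\<Sum>k<n. ?h k)"
    by (simp add: scalar_prod_def isotropic_vec_def atLeast0LessThan)
  also have "\<dots> = (\<Sum>k<2 * (n div 2). ?h k)"
    by (rule sum.mono_neutral_right) (auto simp: isotropic_vec_def)
  also have "\<dots> = (\<Sum>j<n div 2. ?h (2 * j) + ?h (Suc (2 * j)))"
    by (rule sum_pairs)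
  also have "\<dots> = 0"
  proof (rule sum.neutral, rule ballI)
    fix j assume "j \<in> {..<n div 2}"
    then have "?h (2 * j) + ?h (Suc (2 * j)) = f j * g j + (c * c) * (f j * g j)"
      by (simp add: isotropic_vec_def algebra_simps)
    then show "?h (2 * j) + ?h (Suc (2 * j)) = 0"
      by (simp add: assms)
  qed
  finally show ?thesis .
qed

lemma isotropic_vec_orthogonal_last_unit:
  assumes "odd n"
  shows "isotropic_vec c n f \<bullet> unit_vec n (n - 1) = 0"
    and "unit_vec n (n - 1) \<bullet> isotropic_vec c n f = 0"
proof -
  have "n - 1 < n" "2 * (n div 2) = n - 1"
    using assms by (auto elim: oddE)
  then have "isotropic_vec c n f $ (n - 1) = 0"
    by (simp add: isotropic_vec_def)
  then show "isotropic_vec c n f \<bullet> unit_vec n (n - 1) = 0"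
    "unit_vec n (n - 1) \<bullet> isotropic_vec c n f = 0"
    using \<open>n - 1 < n\<close> by (simp_all add: scalar_prod_right_unit scalar_prod_left_unit)
qed

text \<open>
  The even coordinates return the parameter. The set \<open>Func\<close> fixes the values from \<open>n div 2\<close> on,
  which the vector does not see; it is also the set whose cardinal is \<open>|F|\<^sup>m\<close> by definition.
\<close>

lemma inj_on_isotropic_vec: "inj_on (isotropic_vec c n) (Func {..<n div 2} UNIV)"
proof (rule inj_onI, rule ext)
  fix f g j
  assume f: "f \<in> Func {..<n div 2} UNIV" and g: "g \<in> Func {..<n div 2} UNIV"
    and eq: "isotropic_vec c n f = isotropic_vec c n g"
  show "f j = g j"
  proof (cases "j < n div 2")
    case True
    then show ?thesis using eq by (metis isotropic_vec_even)
  next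
    case False
    then show ?thesis using f g by (simp add: Func_def)
  qed
qed

theorem theorem4p3:
  fixes n :: nat
  assumes "\<not> (O_number 2 :: 'a::field vec rel) =o (czero :: 'a vec rel)"
    and "n \<ge> 1"
  shows "cminus_one ( |UNIV :: 'a set| ^c natLeq_on (n div 2)) \<le>o
           clique_number (TD n :: 'a vec ugraph)
       \<and> (odd n \<longrightarrow>
           |UNIV :: 'a set| ^c natLeq_on (n div 2) \<le>o clique_number (TD n :: 'a vec ugraph))"
proof -
  obtain c :: 'a where c: "c * c = - 1"
    using sqrt_minus_one_if_O_number_2[OF assms(1)] .
  define P :: "(nat \<Rightarrow> 'a) set" where "P = Func {..<n div 2} UNIV"
  have cexp: "|UNIV :: 'a set| ^c natLeq_on (n div 2) = |P|"
    by (simp add: cexp_def P_def Field_natLeq_on Field_card_of lessThan_def)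
  \<comment> \<open>The parameter of the zero vector: elements of \<open>Func\<close> are \<open>undefined\<close> off the index set.\<close>
  define z :: "nat \<Rightarrow> 'a" where "z = (\<lambda>j. if j < n div 2 then 0 else undefined)"
  have z: "z \<in> P"
    by (auto simp: z_def P_def Func_def)
  let ?v = "isotropic_vec c n"
  have inj: "inj_on ?v P"
    unfolding P_def by (rule inj_on_isotropic_vec)
  have vz: "?v z = 0\<^sub>v n"
    by (rule eq_vecI) (simp_all add: isotropic_vec_def z_def less_mult_imp_div_less mult.commute)
  define W where "W = ?v ` (P - {z})"
  have W: "W \<subseteq> carrier_vec n - {0\<^sub>v n}"
  proof
    fix x assume "x \<in> W"
    then obtain f where f: "x = ?v f" "f \<in> P" "f \<noteq> z"
      unfolding W_def by blast
    then have "?v f \<noteq> ?v z"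
      using inj_on_eq_iff[OF inj f(2) z] by simp
    with f(1) vz show "x \<in> carrier_vec n - {0\<^sub>v n}"
      by simp
  qed
  have orth: "x \<bullet> y = 0" if "x \<in> W" "y \<in> W" for x y
    using that isotropic_vec_orthogonal[OF c] by (auto simp: W_def)

  have bij: "bij_betw ?v (P - {z}) W"
    unfolding W_def using inj_on_diff[OF inj] by (rule inj_on_imp_bij_betw)
  then have "|P - {z}| =o |W|"
    by (rule card_of_ordIsoI)
  moreover have "|W| \<le>o clique_number (TD n :: 'a vec ugraph)"
    using W orth by (rule TD_clique_card_le)
  ultimately have even_bound: "cminus_one |P| \<le>o clique_number (TD n :: 'a vec ugraph)"
    by (rule ordIso_ordLeq_trans[OF cminus_one_card_of[OF z] ordIso_ordLeq_trans])

  have odd_bound: "|P| \<le>o clique_number (TD n :: 'a vec ugraph)" if n: "odd n"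
  proof -
    let ?e = "unit_vec n (n - 1) :: 'a vec"
    have "n - 1 < n" using assms(2) by simp
    then have ee: "?e \<bullet> ?e = 1" by simp
    have e: "?e \<noteq> 0\<^sub>v n"
      using ee \<open>n - 1 < n\<close> by (metis scalar_prod_left_zero unit_vec_carrier zero_neq_one)
    have We: "x \<bullet> ?e = 0" "?e \<bullet> x = 0" if "x \<in> W" for x
      using that isotropic_vec_orthogonal_last_unit[OF n] by (auto simp: W_def)
    have "?e \<notin> W"
      using We ee by fastforce
    moreover have "?v ` P = insert (0\<^sub>v n) W"
      using z vz unfolding W_def by (metis image_insert insert_Diff)
    \<comment> \<open>The extra vertex takes the place of the zero vector as the image of \<open>z\<close>.\<close>
    ultimately have "inj_on (?v(z := ?e)) P"
      using inj e by (intro inj_on_fun_updI) auto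
    moreover have "(?v(z := ?e)) ` P = insert ?e W"
      unfolding W_def using z by (simp add: fun_upd_image Diff_eq Compl_eq)
    ultimately have "bij_betw (?v(z := ?e)) P (insert ?e W)"
      by (rule bij_betw_imageI)
    then have "|P| =o |insert ?e W|"
      by (rule card_of_ordIsoI)
    moreover have "|insert ?e W| \<le>o clique_number (TD n :: 'a vec ugraph)"
    proof (rule TD_clique_card_le)
      show "insert ?e W \<subseteq> carrier_vec n - {0\<^sub>v n}"
        using W e by auto
      show "x \<bullet> y = 0" if "x \<in> insert ?e W" "y \<in> insert ?e W" "x \<noteq> y" for x y
        using that We orth by blast
    qed
    ultimately show ?thesis
      by (rule ordIso_ordLeq_trans)
  qed
  from even_bound odd_bound show ?thesis
    unfolding cexp by blast
qed

end
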